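(* Let $A\in\mathbb{R}^{N\times d}$ and $y\in\mathbb{R}^N$ satisfy: (a) there exists $x\in\mathbb{R}^d$ with $Ax=y$; (b) $y\neq 0$; (c) $\ker(A)\neq\{0\}$; (d) the problem $\min_{x:Ax=y}\|x\|_{\ell^1}$ has a unique minimizer $g^*$. Let $\mathcal{S}=\operatorname{supp}(g^* )$, $\mathcal{S}^c=\{1,\dots,d\}\setminus\mathcal{S}$, let $\varrho,\varrho^-,\tilde\varrho$ be the null space property constants of $(A,g^* )$ and let $\kappa_*=\frac{\max_{i\in\mathcal{S}}|g^*_i|}{\min_{i\in\mathcal{S}}|g^*_i|}$. Let $\alpha>0$ and let $$x^\infty\in\operatorname*{arg\,min}_{x:Ax=y} D_{H_\alpha}(x,0).$$ Then the following two statements hold. 1. (Upper bound) $$\frac{\|x^\infty-g^*\|_{\ell^1}}{\alpha^{1-\varrho}}\le |\mathcal{S}^c|\,(1+\tilde\varrho)\Big(\min_{i\in\mathcal{S}}|g^*_i|\Big)^{\varrho}\kappa_*^{\varrho^-}\left(1+\frac{\alpha^2}{\big(\min_{i\in\mathcal{S}}|g^*_i|\big)^2}\right)^{\varrho}.$$ 2. (Lower bound) Assume in addition that $$\frac{\alpha}{\min_{i\in\mathcal{S}}|g^*_i|}\le\left(\frac{1}{4\tilde\varrho\,\kappa_*^{\varrho^-}|\mathcal{S}^c|}\right)^{\frac{1}{1-\varrho}}.$$ Then $$\frac{\|x^\infty_{\mathcal{S}^c}-g^*_{\mathcal{S}^c}\|_{\ell^\infty}}{\alpha^{1-\varrho}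}\ge\frac{\|g^*\|_{\ell^\infty}^{\varrho}}{\kappa_*^{\varrho^-}}\left(1-8\tilde\varrho^2|\mathcal{S}^c|\kappa_*^{\varrho^-}\left(\frac{\alpha}{\min_{i\in\mathcal{S}}|g^*_i|}\right)^{1-\varrho}-\kappa_*^{2\varrho^--2\varrho}\left(\frac{\alpha}{\min_{i\in\mathcal{S}}|g^*_i|}\right)^{2\varrho}\right).$$
   Context: For a vector $x\in\mathbb{R}^d$ and $T\subset\{1,\dots,d\}$, $x_T=(x_i)_{i\in T}$ and $\operatorname{supp}(x)=\{i: x_i\ne 0\}$. For a differentiable strictly convex $F:\mathbb{R}^d\to\mathbb{R}$ the Bregman divergence is $D_F(p,q)=F(p)-F(q)-\langle\nabla F(q),p-q\rangle$. For $\alpha>0$, $$H_\alpha(z)=\sum_{i=1}^d\left(z_i\operatorname{arsinh}\Big(\frac{z_i}{2\alpha}\Big)-\sqrt{z_i^2+4\alpha^2}\right),\qquad z\in\mathbb{R}^d.$$ Null space property constants of $(A,g^* )$ (with $\mathcal{S}=\operatorname{supp}(g^* )$): $$\varrho=\sup_{0\ne n\in\ker A}\frac{-\sum_{i\in\mathcal{S}}\operatorname{sign}(g^*_i)n_i}{\|n_{\mathcal{S}^c}\|_{\ell^1}},\quad \varrho^-=\sup_{0\ne n\in\ker A}\frac{\sum_{i\in\mathcal{S}:\operatorname{sign}(g^*_i)n_i<0}|n_i|}{\|n_{\mathcal{S}^c}\|_{\ell^1}},\quad \tilde\varrho=\sup_{0\ne n\in\ker A}\frac{\|n_{\mathcal{S}}\|_{\ell^1}}{\|n_{\mathcal{S}^c}\|_{\ell^1}}.$$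 Under (a)–(d) these are well defined (one has $n_{\mathcal{S}^c}\neq0$ for all $0\ne n\in\ker A$), $0\le\varrho<1$, and $\varrho^-,\tilde\varrho\in[0,\infty)$. *)

theory Defs
  imports "HOL-Analysis.Analysis"
begin

definition supp :: "real ^ 'd \<Rightarrow> 'd set" where
  "supp x = {i. x $ i \<noteq> 0}"

text \<open>The subvector of \<open>x\<close> with indices in \<open>T\<close> is represented by its extension by zero to all
  indices; this changes neither its l1-norm nor its maximum norm.\<close>

definition restrict_vec :: "real ^ 'd \<Rightarrow> 'd set \<Rightarrow> real ^ 'd" where
  "restrict_vec x T = (\<chi> i. if i \<in> T then x $ i else 0)"

definition l1_norm :: "real ^ 'd \<Rightarrow> real" where
  "l1_norm x = (\<Sum>i\<in>UNIV. \<bar>x $ i\<bar>)"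

definition gradient :: "(real ^ 'd \<Rightarrow> real) \<Rightarrow> real ^ 'd \<Rightarrow> real ^ 'd" where
  "gradient F q = (THE D. GDERIV F q :> D)"

text \<open>Only meaningful for differentiable, strictly convex \<open>F\<close>.\<close>

definition bregman_div :: "(real ^ 'd \<Rightarrow> real) \<Rightarrow> real ^ 'd \<Rightarrow> real ^ 'd \<Rightarrow> real" where
  "bregman_div F p q = F p - F q - gradient F q \<bullet> (p - q)"

definition hyp_entropy :: "real \<Rightarrow> real ^ 'd \<Rightarrow> real" where
  "hyp_entropy \<alpha> z =
     (\<Sum>i\<in>UNIV. z $ i * arsinh (z $ i / (2 * \<alpha>)) - sqrt ((z $ i)\<^sup>2 + 4 * \<alpha>\<^sup>2))"

definition matrix_ker :: "real ^ 'd ^ 'n \<Rightarrow> (real ^ 'd) set" where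
  "matrix_ker A = {n. A *v n = 0}"

text \<open>The null space property constants. The suprema are taken in the reals, so they have their
  intended meaning only if the index set is nonempty and the quotients are bounded. This is the
  case (with nonzero denominators) if the kernel of \<open>A\<close> is nontrivial and \<open>g\<close> is the unique
  l1-minimizer on \<open>{x. A *v x = A *v g}\<close>.\<close>

definition nsp_const :: "real ^ 'd ^ 'n \<Rightarrow> real ^ 'd \<Rightarrow> real" where
  "nsp_const A g =
     (SUP n \<in> matrix_ker A - {0}.
        - (\<Sum>i\<in>supp g. sgn (g $ i) * n $ i) / l1_norm (restrict_vec n (- supp g)))"

definition nsp_const_minus :: "real ^ 'd ^ 'n \<Rightarrow> real ^ 'd \<Rightarrow> real" where
  "nsp_const_minus A g =
     (SUP n \<in> matrix_ker A - {0}.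
        (\<Sum>i\<in>{i \<in> supp g. sgn (g $ i) * n $ i < 0}. \<bar>n $ i\<bar>)
          / l1_norm (restrict_vec n (- supp g)))"

text \<open>The next constant can be \<open>0\<close>. A bound by a positive power of its reciprocal is then to be read
  as vacuous, whereas \<open>1 / 0 = 0\<close> in HOL; such a bound needs the explicit alternative
  \<open>nsp_const_tilde A g = 0\<close>.\<close>

definition nsp_const_tilde :: "real ^ 'd ^ 'n \<Rightarrow> real ^ 'd \<Rightarrow> real" where
  "nsp_const_tilde A g =
     (SUP n \<in> matrix_ker A - {0}.
        l1_norm (restrict_vec n (supp g)) / l1_norm (restrict_vec n (- supp g)))"

definition min_abs :: "real ^ 'd \<Rightarrow> real" where
  "min_abs g = (MIN i\<in>supp g. \<bar>g $ i\<bar>)"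

definition max_abs :: "real ^ 'd \<Rightarrow> real" where
  "max_abs g = (MAX i\<in>supp g. \<bar>g $ i\<bar>)"

definition kappa :: "real ^ 'd \<Rightarrow> real" where
  "kappa g = max_abs g / min_abs g"

end

theory Submission
  imports Defs
begin

text \<open>Put \<open>h z = arsinh (z / (2 \<alpha>))\<close>, the derivative of a summand of \<open>hyp_entropy \<alpha>\<close>. As
  the gradient of the latter vanishes at 0, the minimizer \<open>x\<close> is characterized by
  \<open>(\<Sum>i. n\<^sub>i * h x\<^sub>i) = 0\<close> for all \<open>n\<close> in the kernel of \<open>A\<close>.

  Upper bound: take \<open>n = x - g\<close>. On the support of \<open>g\<close>, monotonicity of \<open>h\<close> allows \<open>h x\<^sub>i\<close> to be
  replaced by \<open>h g\<^sub>i\<close>, which deviates from the value at the smallest entry by at most \<open>ln \<kappa>\<close>; the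
  null space constants and Jensen's inequality for \<open>z ln z\<close> then bound the mean of the entries
  off the support.

  Lower bound: let \<open>n\<close> run through the whole kernel. The upper bound shows that \<open>x\<close> is close to \<open>g\<close>
  on the support, so the optimality condition bounds \<open>h\<close> of the largest entry off the support
  from below by nearly \<open>\<rho> ln (max_abs g / \<alpha>) - \<rho>m ln \<kappa>\<close>, and \<open>h\<close> is inverted by \<open>sinh\<close>.\<close>

section \<open>Logarithmic estimates for arsinh, Bernoulli's and Jensen's inequalities\<close>

lemma arsinh_mono: "a \<le> b \<Longrightarrow> arsinh a \<le> arsinh b" for a b :: real
  using arsinh_less_iff_real[of b a] by linarith

lemma ln_double_le_arsinh:
  fixes u :: real
  assumes "0 < u"
  shows "ln (2 * u) \<le> arsinh u"
proof -
  have "u \<le> sqrt (u\<^sup>2 + 1)"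
    by (rule real_le_rsqrt) simp
  then show ?thesis
    using assms by (simp add: arsinh_real_def)
qed

text \<open>From \<open>sqrt (u\<^sup>2 + 1) \<le> u + 1 / (2 * u)\<close>. The product form is
  chosen because \<open>u = m / (2 * \<alpha>)\<close> turns it into
  \<open>m / \<alpha> * (1 + \<alpha>\<^sup>2 / m\<^sup>2)\<close>, the source of the last factor of
  the upper bound.\<close>

lemma arsinh_le_ln:
  fixes u :: real
  assumes "0 < u"
  shows "arsinh u \<le> ln (2 * u * (1 + 1 / (2 * u)\<^sup>2))"
proof -
  have "sqrt (u\<^sup>2 + 1) \<le> u + 1 / (2 * u)"
    using assms by (intro real_le_lsqrt) (auto simp: power2_eq_square field_simps)
  also have "\<dots> + u = 2 * u * (1 + 1 / (2 * u)\<^sup>2)"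
    using assms by (simp add: power2_eq_square field_simps)
  finally have "u + sqrt (u\<^sup>2 + 1) \<le> 2 * u * (1 + 1 / (2 * u)\<^sup>2)"
    by simp
  then show ?thesis
    using arsinh_real_aux[of u] by (simp add: arsinh_real_def)
qed

text \<open>On the positive axis \<open>sqrt (u\<^sup>2 + 1) / u\<close> is nonincreasing, hence so
  is \<open>arsinh u - ln u\<close>.\<close>

lemma arsinh_diff_le_ln:
  fixes a b :: real
  assumes "0 < a" "a \<le> b"
  shows "arsinh b - arsinh a \<le> ln (b / a)"
proof -
  have "sqrt (a\<^sup>2 * (b\<^sup>2 + 1)) \<le> sqrt (b\<^sup>2 * (a\<^sup>2 + 1))"
    using power_mono[of a b 2] assms by (simp add: algebra_simps)
  then have "a * sqrt (b\<^sup>2 + 1) \<le> b * sqrt (a\<^sup>2 + 1)"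
    using assms by (simp add: real_sqrt_mult)
  then have "(b + sqrt (b\<^sup>2 + 1)) / (a + sqrt (a\<^sup>2 + 1)) \<le> b / a"
    using assms arsinh_real_aux[of a] by (simp add: field_simps)
  then have "ln ((b + sqrt (b\<^sup>2 + 1)) / (a + sqrt (a\<^sup>2 + 1))) \<le> ln (b / a)"
    using assms arsinh_real_aux[of a] arsinh_real_aux[of b] by simp
  then show ?thesis
    using arsinh_real_aux[of a] arsinh_real_aux[of b] by (simp add: arsinh_real_def ln_div)
qed

text \<open>Bernoulli's inequality, as weighted AM-GM of \<open>1 + u\<close> and
  \<open>1\<close>.\<close>

lemma powr_one_plus_le:
  fixes u r :: real
  assumes "0 \<le> u" "0 \<le> r" "r \<le> 1"
  shows "(1 + u) powr r \<le> 1 + r * u"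
  using Youngs_inequality_0[of r "1 - r" "1 + u" 1] assms by (simp add: algebra_simps)

text \<open>Since \<open>s\<^sup>2 \<le> s \<le> s powr (1 - r)\<close>, Bernoulli's bound
  \<open>1 + r * s\<^sup>2\<close> is at most 5/4. The last hypothesis is what the smallness
  assumption of the lower bound supplies.\<close>

lemma powr_one_plus_sq_le:
  fixes s r p :: real
  assumes "0 < s" "s < 1" "0 \<le> r" "r < 1" "r * s powr (1 - r) \<le> 1 / 4"
  shows "(1 + s\<^sup>2) powr r \<le> 5 / 4"
proof -
  have "s\<^sup>2 \<le> s"
    using assms by (simp add: power2_eq_square)
  also have "s = s powr 1"
    using assms by simp
  also have "\<dots> \<le> s powr (1 - r)"
    using assms by (intro powr_mono') auto
  finally have "r * s\<^sup>2 \<le> r * s powr (1 - r)"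
    using assms by (intro mult_left_mono) auto
  then show ?thesis
    using powr_one_plus_le[of "s\<^sup>2" r] assms by simp
qed

text \<open>Jensen's inequality for \<open>z ln (z / \<alpha>)\<close>, via its tangent at the mean.\<close>

lemma sum_mult_arsinh_ge:
  fixes z :: "'a \<Rightarrow> real"
  assumes "finite T" "\<alpha> > 0" "\<And>i. i \<in> T \<Longrightarrow> z i \<ge> 0" "sum z T > 0"
  shows "sum z T * ln (sum z T / card T / \<alpha>) \<le> (\<Sum>i\<in>T. z i * arsinh (z i / (2 * \<alpha>)))"
proof -
  define a where "a = sum z T / card T"
  have T: "T \<noteq> {}"
    using assms(4) by auto
  then have card: "card T > 0"
    using assms(1) by (simp add: card_gt_0_iff)
  then have a: "a > 0"
    using assms(4) by (simp add: a_def)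
  have "z i * ln (a / \<alpha>) + (z i - a) \<le> z i * arsinh (z i / (2 * \<alpha>))" if "i \<in> T" for i
  proof (cases "z i = 0")
    case True
    then show ?thesis using a by simp
  next
    case False
    then have z: "z i > 0"
      using assms(3)[OF that] by simp
    \<comment> \<open>Multiplied by \<open>z i\<close>, this is the tangent inequality of the convex
      function \<open>z ln z\<close> at \<open>a\<close>.\<close>
    have "ln (a / z i) \<le> a / z i - 1"
      using a z by (intro ln_le_minus_one) simp
    then have "z i * (ln (a / z i)) \<le> z i * (a / z i - 1)"
      using z by (intro mult_left_mono) auto
    then have "z i * ln a + (z i - a) \<le> z i * ln (z i)"
      using z a by (simp add: ln_div algebra_simps)
    then have "z i * ln (a / \<alpha>) + (z i - a) \<le> z i * ln (z i / \<alpha>)"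
      using z a assms(2) by (simp add: ln_div algebra_simps)
    also have "\<dots> \<le> z i * arsinh (z i / (2 * \<alpha>))"
      using ln_double_le_arsinh[of "z i / (2 * \<alpha>)"] z assms(2) by (intro mult_left_mono) auto
    finally show ?thesis .
  qed
  then have "(\<Sum>i\<in>T. z i * ln (a / \<alpha>) + (z i - a)) \<le> (\<Sum>i\<in>T. z i * arsinh (z i / (2 * \<alpha>)))"
    by (rule sum_mono)
  \<comment> \<open>The terms \<open>z i - a\<close> cancel because \<open>a\<close> is the
    mean.\<close>
  moreover have "(\<Sum>i\<in>T. z i * ln (a / \<alpha>) + (z i - a)) = sum z T * ln (a / \<alpha>)"
    using card by (simp add: sum.distrib sum_subtractf a_def flip: sum_distrib_right)
  ultimately show ?thesis
    by (simp add: a_def)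
qed

section \<open>Gradient of the hyperbolic entropy and the first-order condition\<close>

text \<open>In each summand the product rule term
  \<open>t / sqrt (t\<^sup>2 + 4 * \<alpha>\<^sup>2)\<close> cancels against the derivative of the
  square root, so that only \<open>arsinh\<close> remains.\<close>

lemma hyp_entropy_gderiv:
  fixes q :: "real ^ 'd"
  assumes "\<alpha> > 0"
  shows "GDERIV (hyp_entropy \<alpha>) q :> (\<chi> i. arsinh (q $ i / (2 * \<alpha>)))"
proof -
  define k where "k t = t * arsinh (t / (2 * \<alpha>)) - sqrt (t\<^sup>2 + 4 * \<alpha>\<^sup>2)" for t :: real
  have k: "(k has_field_derivative arsinh (t / (2 * \<alpha>))) (at t)" for t
  proof -
    have pos: "t\<^sup>2 + 4 * \<alpha>\<^sup>2 > 0"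
      using assms by (simp add: add_nonneg_pos)
    have s: "sqrt ((t / (2 * \<alpha>))\<^sup>2 + 1) = sqrt (t\<^sup>2 + 4 * \<alpha>\<^sup>2) / (2 * \<alpha>)"
    proof -
      have "(t / (2 * \<alpha>))\<^sup>2 + 1 = (t\<^sup>2 + 4 * \<alpha>\<^sup>2) / (2 * \<alpha>)\<^sup>2"
        using assms by (simp add: field_simps)
      then show ?thesis
        using assms by (simp only: real_sqrt_divide real_sqrt_abs)
    qed
    have "((\<lambda>t. arsinh (t / (2 * \<alpha>))) has_field_derivative
        1 / sqrt ((t / (2 * \<alpha>))\<^sup>2 + 1) * (1 / (2 * \<alpha>))) (at t)"
      by (rule DERIV_chain2[OF arsinh_real_has_field_derivative])
        (use assms in \<open>auto intro!: derivative_eq_intros\<close>)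
    then have "((\<lambda>t. arsinh (t / (2 * \<alpha>))) has_field_derivative
        1 / sqrt (t\<^sup>2 + 4 * \<alpha>\<^sup>2)) (at t)"
      unfolding s using assms by simp
    moreover have "((\<lambda>t. sqrt (t\<^sup>2 + 4 * \<alpha>\<^sup>2)) has_field_derivative
        t / sqrt (t\<^sup>2 + 4 * \<alpha>\<^sup>2)) (at t)"
      using pos by (auto intro!: derivative_eq_intros simp: field_simps)
    ultimately have "(k has_field_derivative
        t * (1 / sqrt (t\<^sup>2 + 4 * \<alpha>\<^sup>2)) + 1 * arsinh (t / (2 * \<alpha>))
          - t / sqrt (t\<^sup>2 + 4 * \<alpha>\<^sup>2)) (at t)"
      unfolding k_def by (intro DERIV_diff DERIV_mult' DERIV_ident)
    then show ?thesis
      by simp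
  qed
  have "((\<lambda>z. k (z $ i)) has_derivative (\<lambda>h. arsinh (q $ i / (2 * \<alpha>)) * h $ i)) (at q)" for i
    using has_derivative_compose[OF bounded_linear_imp_has_derivative[OF bounded_linear_vec_nth[of i]]
        k[of "q $ i", unfolded has_field_derivative_def]]
    by simp
  then have "((\<lambda>z. \<Sum>i\<in>UNIV. k (z $ i)) has_derivative
      (\<lambda>h. \<Sum>i\<in>UNIV. arsinh (q $ i / (2 * \<alpha>)) * h $ i)) (at q)"
    by (intro has_derivative_sum)
  moreover have "(\<lambda>h. \<Sum>i\<in>UNIV. arsinh (q $ i / (2 * \<alpha>)) * h $ i)
      = (\<lambda>h. h \<bullet> (\<chi> i. arsinh (q $ i / (2 * \<alpha>))))"
    by (auto simp: inner_vec_def mult.commute)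
  moreover have "(\<lambda>z :: real ^ 'd. \<Sum>i\<in>UNIV. k (z $ i)) = hyp_entropy \<alpha>"
    by (auto simp: hyp_entropy_def k_def)
  ultimately show ?thesis
    by (simp add: gderiv_def)
qed

lemma gradient_eq:
  assumes "GDERIV F q :> D"
  shows "gradient F q = D"
  unfolding gradient_def
proof (rule the_equality)
  show "GDERIV F q :> D"
    by (rule assms)
next
  fix D' assume "GDERIV F q :> D'"
  then have "(\<lambda>h. h \<bullet> D') = (\<lambda>h. h \<bullet> D)"
    using assms by (auto simp: gderiv_def intro: has_derivative_unique)
  then show "D' = D"
    by (metis vector_eq_ldot)
qed

text \<open>The divergence from 0 is the entropy up to a constant. The line
  \<open>x + t *\<^sub>R n\<close> stays feasible, so the derivative of the entropy along it
  vanishes at \<open>t = 0\<close>.\<close>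

lemma bregman_minimizer_stationary:
  fixes A :: "real ^ 'd ^ 'n"
  assumes "\<alpha> > 0"
    and min: "is_arg_min (\<lambda>x. bregman_div (hyp_entropy \<alpha>) x 0) (\<lambda>x. A *v x = y) x"
    and n: "n \<in> matrix_ker A"
  shows "(\<Sum>i\<in>UNIV. n $ i * arsinh (x $ i / (2 * \<alpha>))) = 0"
proof -
  let ?D = "\<chi> i. arsinh (x $ i / (2 * \<alpha>))"
  have "gradient (hyp_entropy \<alpha>) (0 :: real ^ 'd) = 0"
    using gradient_eq[OF hyp_entropy_gderiv[OF assms(1), of 0]] by (simp add: vec_eq_iff)
  then have breg: "bregman_div (hyp_entropy \<alpha>) z 0 = hyp_entropy \<alpha> z - hyp_entropy \<alpha> (0 :: real ^ 'd)"
    for z :: "real ^ 'd"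
    by (simp add: bregman_div_def)
  have le: "hyp_entropy \<alpha> x \<le> hyp_entropy \<alpha> (x + t *\<^sub>R n)" for t
  proof -
    have "A *v (x + t *\<^sub>R n) = y"
      using min n by (simp add: is_arg_min_def matrix_ker_def matrix_vector_right_distrib
          matrix_vector_mult_scaleR)
    then show ?thesis
      using min unfolding is_arg_min_def breg by force
  qed
  have "(hyp_entropy \<alpha> has_derivative (\<lambda>h. h \<bullet> ?D)) (at (x + 0 *\<^sub>R n))"
    using hyp_entropy_gderiv[OF assms(1), of x] by (simp add: gderiv_def)
  then have "((\<lambda>t. hyp_entropy \<alpha> (x + t *\<^sub>R n)) has_derivative (\<lambda>t. (t *\<^sub>R n) \<bullet> ?D)) (at 0)"
    by (rule has_derivative_compose[rotated, where g = "hyp_entropy \<alpha>"])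
      (auto intro!: derivative_eq_intros)
  then have "((\<lambda>t. hyp_entropy \<alpha> (x + t *\<^sub>R n)) has_real_derivative (n \<bullet> ?D)) (at 0)"
    by (simp add: has_field_derivative_def mult.commute[of _ "n \<bullet> ?D"])
  then have "n \<bullet> ?D = 0"
    by (rule DERIV_local_min[where d = 1]) (use le in auto)
  then show ?thesis
    by (simp add: inner_vec_def)
qed

section \<open>Unique l1-minimizers and the null space constants\<close>

lemma l1_norm_restrict: "l1_norm (restrict_vec x T) = (\<Sum>i\<in>T. \<bar>x $ i\<bar>)"
  unfolding l1_norm_def restrict_vec_def by (rule sum.mono_neutral_cong_right) auto

text \<open>On the compact unit sphere of the kernel \<open>f\<close> attains a positive minimum,
  and homogeneity extends the bound. This makes strict inequalities on the kernel uniform, so that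
  they survive a supremum.\<close>

lemma matrix_ker_coercive:
  fixes A :: "real ^ 'd ^ 'n"
  assumes cont: "continuous_on UNIV f"
    and hom: "\<And>c n. 0 < c \<Longrightarrow> f (c *\<^sub>R n) = c * f n"
    and pos: "\<And>n. n \<in> matrix_ker A \<Longrightarrow> n \<noteq> 0 \<Longrightarrow> 0 < f n"
  shows "\<exists>c>0. \<forall>n\<in>matrix_ker A. n \<noteq> 0 \<longrightarrow> c * norm n \<le> f n"
proof -
  let ?K = "matrix_ker A \<inter> sphere 0 1"
  have "closed (matrix_ker A)"
    unfolding matrix_ker_def by (intro closed_Collect_eq continuous_intros)
  then have "compact ?K"
    by (simp add: closed_Int_compact)
  have unit: "inverse (norm n) *\<^sub>R n \<in> ?K" if "n \<in> matrix_ker A" "n \<noteq> 0" for n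
    using that by (simp add: matrix_ker_def matrix_vector_mult_scaleR)
  show ?thesis
  proof (cases "?K = {}")
    case True
    then show ?thesis
      using unit by (metis empty_iff zero_less_one)
  next
    case False
    obtain u where u: "u \<in> ?K" "\<And>v. v \<in> ?K \<Longrightarrow> f u \<le> f v"
      using continuous_attains_inf[OF \<open>compact ?K\<close> False continuous_on_subset[OF cont subset_UNIV]]
      by blast
    have "u \<noteq> 0"
      using u(1) by auto
    then have "0 < f u"
      using u(1) pos by blast
    moreover have "f u * norm n \<le> f n" if n: "n \<in> matrix_ker A" "n \<noteq> 0" for n
    proof -
      have "f u \<le> inverse (norm n) * f n"
        using u(2)[OF unit[OF n]] hom[of "inverse (norm n)" n] n(2) by simp
      then show ?thesis
        using n(2) by (simp add: field_simps)
    qed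
    ultimately show ?thesis
      by blast
  qed
qed

text \<open>The right-hand side \<open>y\<close> is represented by \<open>A *v g\<close>, and
  \<open>g \<noteq> 0\<close> stands for \<open>y \<noteq> 0\<close>.\<close>

locale unique_l1_minimizer =
  fixes A :: "real ^ 'd ^ 'n" and g :: "real ^ 'd"
  assumes ker_nontrivial: "matrix_ker A \<noteq> {0}"
    and g_nonzero: "g \<noteq> 0"
    and l1_less: "\<And>x. A *v x = A *v g \<Longrightarrow> x \<noteq> g \<Longrightarrow> l1_norm g < l1_norm x"
begin

text \<open>\<open>off\<close> is the common denominator of the three null space quotients;
  \<open>- sgnd\<close>, \<open>neg\<close> and \<open>on\<close> are their numerators.\<close>

abbreviation off :: "real ^ 'd \<Rightarrow> real" where "off n \<equiv> \<Sum>i\<in>- supp g. \<bar>n $ i\<bar>"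
abbreviation on :: "real ^ 'd \<Rightarrow> real" where "on n \<equiv> \<Sum>i\<in>supp g. \<bar>n $ i\<bar>"
abbreviation sgnd :: "real ^ 'd \<Rightarrow> real" where "sgnd n \<equiv> \<Sum>i\<in>supp g. sgn (g $ i) * n $ i"
abbreviation neg :: "real ^ 'd \<Rightarrow> real" where
  "neg n \<equiv> \<Sum>i\<in>{i \<in> supp g. sgn (g $ i) * n $ i < 0}. \<bar>n $ i\<bar>"

lemma supp_nonempty: "supp g \<noteq> {}"
  using g_nonzero by (auto simp: supp_def vec_eq_iff)

lemma min_abs_pos: "0 < min_abs g"
  unfolding min_abs_def using supp_nonempty by (subst Min_gr_iff) (auto simp: supp_def)

lemma min_abs_le: "i \<in> supp g \<Longrightarrow> min_abs g \<le> \<bar>g $ i\<bar>"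
  unfolding min_abs_def by simp

lemma abs_le_max_abs: "i \<in> supp g \<Longrightarrow> \<bar>g $ i\<bar> \<le> max_abs g"
  unfolding max_abs_def by simp

lemma min_abs_le_max_abs: "min_abs g \<le> max_abs g"
  using supp_nonempty min_abs_le abs_le_max_abs by (meson all_not_in_conv order_trans)

lemma max_abs_pos: "0 < max_abs g"
  using min_abs_pos min_abs_le_max_abs by linarith

lemma kappa_ge_1: "1 \<le> kappa g"
  unfolding kappa_def using min_abs_pos min_abs_le_max_abs by simp

lemma infnorm_eq_max_abs: "infnorm g = max_abs g"
proof -
  have "max_abs g \<in> (\<lambda>i. \<bar>g $ i\<bar>) ` supp g"
    unfolding max_abs_def using supp_nonempty by (intro Max_in) auto
  moreover have "\<bar>g $ i\<bar> \<le> max_abs g" for i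
    using abs_le_max_abs[of i] max_abs_pos by (cases "i \<in> supp g") (auto simp: supp_def)
  ultimately show ?thesis
    unfolding infnorm_cart by (intro cSup_eq_maximum) auto
qed

lemma minus_in_ker: "n \<in> matrix_ker A \<Longrightarrow> - n \<in> matrix_ker A"
  using matrix_vector_mult_scaleR[of A "-1" n] by (simp add: matrix_ker_def)

lemma l1_norm_split: "l1_norm n = on n + off n"
  unfolding l1_norm_def by (subst sum.union_disjoint[symmetric]) (auto simp: Compl_partition)

text \<open>For small \<open>t > 0\<close> the signs on the support do not change, so \<open>l1_norm (g + t n)\<close> is
  \<open>l1_norm g + t (sgnd n + off n)\<close>.\<close>

lemma neg_sgnd_less_off:
  assumes n: "n \<in> matrix_ker A" "n \<noteq> 0"
  shows "- sgnd n < off n"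
proof -
  \<comment> \<open>With this choice \<open>t *\<^sub>R n\<close> has norm \<open>min_abs g\<close>,
    so no entry on the support crosses 0.\<close>
  define t where "t = min_abs g / norm n"
  have t: "0 < t"
    using min_abs_pos n(2) by (simp add: t_def)
  have "A *v (g + t *\<^sub>R n) = A *v g"
    using n(1) by (simp add: matrix_ker_def matrix_vector_right_distrib matrix_vector_mult_scaleR)
  then have less: "l1_norm g < l1_norm (g + t *\<^sub>R n)"
    using l1_less t n(2) by simp
  have "\<bar>g $ i + t * n $ i\<bar> = \<bar>g $ i\<bar> + t * (sgn (g $ i) * n $ i)" if "i \<in> supp g" for i
  proof -
    have "t * \<bar>n $ i\<bar> \<le> t * norm n"
      using component_le_norm_cart t by (intro mult_left_mono) auto
    also have "\<dots> \<le> \<bar>g $ i\<bar>"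
      using n(2) min_abs_le[OF that] by (simp add: t_def)
    finally have "\<bar>t * n $ i\<bar> \<le> \<bar>g $ i\<bar>"
      using t by (simp add: abs_mult)
    then show ?thesis
      using that by (cases "g $ i > 0") (auto simp: supp_def sgn_if abs_if split: if_splits)
  qed
  then have "on (g + t *\<^sub>R n) = on g + t * sgnd n"
    by (simp add: sum.distrib sum_distrib_left)
  moreover have "off (g + t *\<^sub>R n) = t * off n" "off g = 0"
    using t by (simp_all add: supp_def abs_mult sum_distrib_left)
  ultimately have "0 < t * (sgnd n + off n)"
    using less unfolding l1_norm_split by (simp add: algebra_simps)
  then show ?thesis
    using t by (simp add: zero_less_mult_iff)
qed

text \<open>Applying \<open>neg_sgnd_less_off\<close> to \<open>n\<close> and to \<open>- n\<close>
  gives \<open>\<bar>sgnd n\<bar> < off n\<close>.\<close>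

lemma off_pos:
  assumes n: "n \<in> matrix_ker A" "n \<noteq> 0"
  shows "0 < off n"
proof -
  have "- n \<in> matrix_ker A"
    using n(1) by (rule minus_in_ker)
  then have "sgnd n < off n"
    using neg_sgnd_less_off[of "- n"] n(2) by (simp add: sum_negf)
  then show ?thesis
    using neg_sgnd_less_off[OF n] by linarith
qed

lemma neg_sgnd_le_on: "- sgnd n \<le> on n"
  unfolding sum_negf[symmetric] by (intro sum_mono) (auto simp: sgn_if)

lemma neg_sgnd_le_neg: "- sgnd n \<le> neg n"
proof -
  have "- sgnd n \<le> (\<Sum>i\<in>supp g. if sgn (g $ i) * n $ i < 0 then \<bar>n $ i\<bar> else 0)"
    unfolding sum_negf[symmetric] by (intro sum_mono) (auto simp: sgn_if)
  also have "\<dots> = neg n"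
    by (simp add: sum.inter_filter)
  finally show ?thesis .
qed

lemma neg_le_on: "neg n \<le> on n"
  by (intro sum_mono2) auto

lemma ker_nonempty: "matrix_ker A - {0} \<noteq> {}"
proof -
  have "0 \<in> matrix_ker A"
    by (simp add: matrix_ker_def)
  then show ?thesis
    using ker_nontrivial by blast
qed

text \<open>Coercivity of \<open>off\<close> on the kernel. As \<open>on\<close> dominates the other
  two numerators, this bounds all three quotients from above, which gives the real suprema their
  intended meaning.\<close>

lemma ratio_on_bdd: "bdd_above ((\<lambda>n. on n / off n) ` (matrix_ker A - {0}))"
proof -
  have cont: "continuous_on UNIV off"
    by (intro continuous_intros)
  have hom: "off (c *\<^sub>R n) = c * off n" if "0 < c" for c n
    using that by (simp add: abs_mult sum_distrib_left)
  obtain c where c: "0 < c"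
    "\<And>n. n \<in> matrix_ker A \<Longrightarrow> n \<noteq> 0 \<Longrightarrow> c * norm n \<le> off n"
    using matrix_ker_coercive[OF cont hom off_pos] by blast
  have "on n / off n \<le> real (card (supp g)) / c" if n: "n \<in> matrix_ker A" "n \<noteq> 0" for n
  proof -
    have "on n \<le> real (card (supp g)) * norm n"
      by (rule sum_bounded_above) (simp add: component_le_norm_cart)
    then have "on n * c \<le> real (card (supp g)) * (c * norm n)"
      using c(1) by (simp add: mult.left_commute mult.commute)
    also have "\<dots> \<le> real (card (supp g)) * off n"
      using c(2)[OF n] by (intro mult_left_mono) auto
    finally show ?thesis
      using c(1) off_pos[OF n] by (simp add: field_simps)
  qed
  then show ?thesis
    by (intro bdd_aboveI2) auto
qed

lemma ratio_bdd:
  assumes "\<And>n. f n \<le> on n"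
  shows "bdd_above ((\<lambda>n. f n / off n) ` (matrix_ker A - {0}))"
proof -
  obtain B where B: "\<And>n. n \<in> matrix_ker A - {0} \<Longrightarrow> on n / off n \<le> B"
    using ratio_on_bdd unfolding bdd_above_def by auto
  have "f n / off n \<le> B" if "n \<in> matrix_ker A - {0}" for n
  proof -
    have "0 < off n"
      using off_pos that by auto
    then have "f n / off n \<le> on n / off n"
      using assms by (intro divide_right_mono) auto
    then show ?thesis
      using B[OF that] by linarith
  qed
  then show ?thesis
    by (intro bdd_aboveI2) auto
qed

text \<open>Multiplying out the denominator admits \<open>n = 0\<close> as well, where
  \<open>f 0 \<le> on 0 = 0\<close>; later \<open>n = x - g\<close> may vanish.\<close>

lemma le_SUP_ratio:
  assumes "\<And>n. f n \<le> on n" and n: "n \<in> matrix_ker A"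
  shows "f n \<le> (SUP n\<in>matrix_ker A - {0}. f n / off n) * off n"
proof (cases "n = 0")
  case True
  then show ?thesis
    using assms(1)[of 0] by simp
next
  case False
  then have "f n / off n \<le> (SUP n\<in>matrix_ker A - {0}. f n / off n)"
    using n by (intro cSUP_upper ratio_bdd assms(1)) auto
  then show ?thesis
    using off_pos[OF n False] by (simp add: pos_divide_le_eq)
qed

lemma neg_sgnd_le: "n \<in> matrix_ker A \<Longrightarrow> - sgnd n \<le> nsp_const A g * off n"
  unfolding nsp_const_def l1_norm_restrict by (rule le_SUP_ratio[OF neg_sgnd_le_on])

lemma neg_le: "n \<in> matrix_ker A \<Longrightarrow> neg n \<le> nsp_const_minus A g * off n"
  unfolding nsp_const_minus_def l1_norm_restrict by (rule le_SUP_ratio[OF neg_le_on])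

lemma on_le: "n \<in> matrix_ker A \<Longrightarrow> on n \<le> nsp_const_tilde A g * off n"
  unfolding nsp_const_tilde_def l1_norm_restrict by (rule le_SUP_ratio) simp

lemma nsp_const_le:
  assumes "\<And>n. n \<in> matrix_ker A \<Longrightarrow> n \<noteq> 0 \<Longrightarrow> - sgnd n \<le> c * off n"
  shows "nsp_const A g \<le> c"
  unfolding nsp_const_def l1_norm_restrict
proof (rule cSUP_least[OF ker_nonempty])
  fix n assume "n \<in> matrix_ker A - {0}"
  then have "- sgnd n \<le> c * off n" "0 < off n"
    using assms off_pos by auto
  then show "- sgnd n / off n \<le> c"
    by (simp only: pos_divide_le_eq)
qed

text \<open>The values of \<open>sgnd\<close> at \<open>n\<close> and \<open>- n\<close> are
  opposite, so the two bounds add up to a nonnegative quantity.\<close>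

lemma nsp_const_nonneg: "0 \<le> nsp_const A g"
proof -
  obtain n where n: "n \<in> matrix_ker A" "n \<noteq> 0"
    using ker_nonempty by blast
  have n': "- n \<in> matrix_ker A"
    using n(1) by (rule minus_in_ker)
  have "0 \<le> nsp_const A g * off n"
    using neg_sgnd_le[OF n(1)] neg_sgnd_le[OF n'] by (simp add: sum_negf)
  then show ?thesis
    using off_pos[OF n] by (simp add: zero_le_mult_iff)
qed

lemma nsp_const_le_tilde: "nsp_const A g \<le> nsp_const_tilde A g"
  by (rule nsp_const_le) (rule order_trans[OF neg_sgnd_le_on on_le])

lemma nsp_const_le_minus: "nsp_const A g \<le> nsp_const_minus A g"
  by (rule nsp_const_le) (rule order_trans[OF neg_sgnd_le_neg neg_le])

text \<open>By coercivity \<open>sgnd n + off n\<close> dominates \<open>c * norm n\<close>, hence a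
  fixed fraction of \<open>off n\<close>; this keeps the supremum away from 1.\<close>

lemma nsp_const_less_1: "nsp_const A g < 1"
proof -
  have cont: "continuous_on UNIV (\<lambda>n. sgnd n + off n)"
    by (intro continuous_intros)
  have hom: "sgnd (c *\<^sub>R n) + off (c *\<^sub>R n) = c * (sgnd n + off n)" if "0 < c" for c n
  proof -
    have "sgnd (c *\<^sub>R n) = c * sgnd n"
      by (simp add: sum_distrib_left mult.left_commute)
    moreover have "off (c *\<^sub>R n) = c * off n"
      using that by (simp add: abs_mult sum_distrib_left)
    ultimately show ?thesis
      by (simp only: distrib_left)
  qed
  have pos: "0 < sgnd n + off n" if "n \<in> matrix_ker A" "n \<noteq> 0" for n
    using neg_sgnd_less_off[OF that] by linarith
  obtain c where c: "0 < c"
    "\<And>n. n \<in> matrix_ker A \<Longrightarrow> n \<noteq> 0 \<Longrightarrow> c * norm n \<le> sgnd n + off n"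
    using matrix_ker_coercive[where f = "\<lambda>n. sgnd n + off n", OF cont hom pos] by blast
  define N where "N = real (card (- supp g)) + 1"
  have N: "0 < N"
    by (simp add: N_def add_nonneg_pos)
  have "nsp_const A g \<le> 1 - c / N"
  proof (rule nsp_const_le)
    fix n assume n: "n \<in> matrix_ker A" "n \<noteq> 0"
    have "off n \<le> real (card (- supp g)) * norm n"
      by (rule sum_bounded_above) (simp add: component_le_norm_cart)
    also have "\<dots> \<le> N * norm n"
      by (simp add: N_def mult_right_mono)
    finally have "c / N * off n \<le> c / N * (N * norm n)"
      using c(1) N by (intro mult_left_mono) auto
    then show "- sgnd n \<le> (1 - c / N) * off n"
      using c(2)[OF n] N by (simp add: algebra_simps)
  qed
  then show ?thesis
    using c(1) N by (smt (verit) divide_pos_pos)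
qed

lemma card_off_pos: "0 < card (- supp g)"
proof -
  obtain n where "n \<in> matrix_ker A" "n \<noteq> 0"
    using ker_nonempty by blast
  then show ?thesis
    using off_pos[of n] by (cases "- supp g = {}") (auto simp: card_gt_0_iff)
qed

end

section \<open>The stationarity condition split along the support\<close>

text \<open>Minimality of the divergence is recorded as its first-order condition along the
  kernel.\<close>

locale entropic_minimizer = unique_l1_minimizer A g
  for A :: "real ^ 'd ^ 'n" and g :: "real ^ 'd" +
  fixes \<alpha> :: real and x :: "real ^ 'd"
  assumes alpha_pos: "0 < \<alpha>"
    and feasible: "A *v x = A *v g"
    and stationary: "\<And>n. n \<in> matrix_ker A \<Longrightarrow> (\<Sum>i\<in>UNIV. n $ i * arsinh (x $ i / (2 * \<alpha>))) = 0"
begin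

abbreviation "h z \<equiv> arsinh (z / (2 * \<alpha>))"
abbreviation "\<rho> \<equiv> nsp_const A g"
abbreviation "\<rho>m \<equiv> nsp_const_minus A g"
abbreviation "\<rho>t \<equiv> nsp_const_tilde A g"
abbreviation "\<kappa> \<equiv> kappa g"
abbreviation "m \<equiv> min_abs g"
abbreviation "M \<equiv> max_abs g"
abbreviation "N \<equiv> real (card (- supp g))"

lemma h_mono: "a \<le> b \<Longrightarrow> h a \<le> h b"
  using alpha_pos by (intro arsinh_mono divide_right_mono) auto

lemma h_abs: "\<bar>h a\<bar> = h \<bar>a\<bar>"
  using h_mono[of 0 a] h_mono[of a 0] arsinh_minus_real[of "a / (2 * \<alpha>)"]
  by (cases "a \<ge> 0") auto

lemma h_diff_le_ln:
  assumes "0 < a" "a \<le> b"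
  shows "h b - h a \<le> ln (b / a)"
  using arsinh_diff_le_ln[of "a / (2 * \<alpha>)" "b / (2 * \<alpha>)"] assms alpha_pos
  by (simp add: divide_right_mono)

text \<open>Combines \<open>h_diff_le_ln\<close> with \<open>ln u \<le> u - 1\<close>. The constant
  \<open>1 / c\<close> does not depend on \<open>\<alpha>\<close>.\<close>

lemma h_lipschitz:
  assumes "0 < c" "c \<le> a" "c \<le> b"
  shows "\<bar>h a - h b\<bar> \<le> \<bar>a - b\<bar> / c"
proof -
  have *: "\<bar>h a - h b\<bar> \<le> \<bar>a - b\<bar> / c" if "c \<le> a" "a \<le> b" for a b
  proof -
    have "h b - h a \<le> ln (b / a)"
      using that assms(1) by (intro h_diff_le_ln) auto
    also have "\<dots> \<le> b / a - 1"
      using that assms(1) by (intro ln_le_minus_one) simp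
    also have "\<dots> = (b - a) / a"
      using that assms(1) by (simp add: field_simps)
    also have "\<dots> \<le> (b - a) / c"
      using that assms(1) by (intro divide_left_mono) auto
    finally show ?thesis
      using h_mono[OF that(2)] that(2) by simp
  qed
  show ?thesis
    using *[of a b] *[of b a] assms by (cases "a \<le> b") (auto simp: abs_minus_commute)
qed

text \<open>As \<open>h\<close> is odd, both factors on the support can be multiplied by the sign of
  \<open>g $ i\<close>; then \<open>h (sgn (g $ i) * x $ i)\<close> is comparable with
  \<open>h \<bar>g $ i\<bar>\<close>.\<close>

lemma ker_balance:
  assumes "n \<in> matrix_ker A"
  shows "(\<Sum>i\<in>- supp g. n $ i * h (x $ i))
    = (\<Sum>i\<in>supp g. - (sgn (g $ i) * n $ i) * h (sgn (g $ i) * x $ i))"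
proof -
  have "(\<Sum>i\<in>supp g. n $ i * h (x $ i)) + (\<Sum>i\<in>- supp g. n $ i * h (x $ i)) = 0"
    using stationary[OF assms] by (subst sum.union_disjoint[symmetric]) (auto simp: Compl_partition)
  moreover have "(\<Sum>i\<in>supp g. n $ i * h (x $ i))
      = (\<Sum>i\<in>supp g. (sgn (g $ i) * n $ i) * h (sgn (g $ i) * x $ i))"
    by (rule sum.cong) (auto simp: supp_def sgn_if)
  ultimately show ?thesis
    by (simp add: sum_negf)
qed

text \<open>Only indices where \<open>n\<close> opposes the sign of \<open>g\<close> contribute
  positively. This is how \<open>\<rho>m\<close> enters both bounds, each time with
  \<open>C = ln \<kappa>\<close>.\<close>

lemma sum_weighted_le_neg:
  assumes "\<And>i. i \<in> supp g \<Longrightarrow> 0 \<le> w i" "\<And>i. i \<in> supp g \<Longrightarrow> w i \<le> C"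
  shows "(\<Sum>i\<in>supp g. - (sgn (g $ i) * n $ i) * w i) \<le> neg n * C"
proof -
  have "- (sgn (g $ i) * n $ i) * w i \<le> (if sgn (g $ i) * n $ i < 0 then \<bar>n $ i\<bar> * C else 0)"
    if "i \<in> supp g" for i
  proof (cases "sgn (g $ i) * n $ i < 0")
    case True
    then have "- (sgn (g $ i) * n $ i) = \<bar>n $ i\<bar>"
      by (auto simp: sgn_if split: if_splits)
    then show ?thesis
      using True assms(2)[OF that] by (simp add: mult_left_mono)
  next
    case False
    then show ?thesis
      using assms(1)[OF that] by (simp add: not_less)
  qed
  then have "(\<Sum>i\<in>supp g. - (sgn (g $ i) * n $ i) * w i)
      \<le> (\<Sum>i\<in>supp g. if sgn (g $ i) * n $ i < 0 then \<bar>n $ i\<bar> * C else 0)"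
    by (rule sum_mono)
  also have "\<dots> = neg n * C"
    by (simp add: sum_distrib_right flip: sum.inter_filter)
  finally show ?thesis .
qed

section \<open>Upper bound from the kernel vector \<open>x - g\<close>\<close>

lemma diff_in_ker: "x - g \<in> matrix_ker A"
  using feasible by (simp add: matrix_ker_def matrix_vector_mult_diff_distrib)

lemma off_diff: "off (x - g) = (\<Sum>i\<in>- supp g. \<bar>x $ i\<bar>)"
  by (rule sum.cong) (auto simp: supp_def)

lemma ln_kappa_nonneg: "0 \<le> ln \<kappa>"
  using kappa_ge_1 by simp

lemma sum_abs_mult_h_le:
  "(\<Sum>i\<in>- supp g. \<bar>x $ i\<bar> * h \<bar>x $ i\<bar>)
    \<le> off (x - g) * (\<rho> * ln (m / \<alpha> * (1 + \<alpha>\<^sup>2 / m\<^sup>2)) + \<rho>m * ln \<kappa>)"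
proof -
  define \<sigma> where "\<sigma> i = sgn (g $ i)" for i
  define d where "d = x - g"
  have "(\<Sum>i\<in>- supp g. \<bar>x $ i\<bar> * h \<bar>x $ i\<bar>) = (\<Sum>i\<in>- supp g. d $ i * h (x $ i))"
    by (rule sum.cong) (auto simp: supp_def d_def abs_if)
  also have "\<dots> = (\<Sum>i\<in>supp g. - (\<sigma> i * d $ i) * h (\<sigma> i * x $ i))"
    using ker_balance[OF diff_in_ker] by (simp add: d_def \<sigma>_def)
  also have "\<dots> \<le> (\<Sum>i\<in>supp g. - (\<sigma> i * d $ i) * h \<bar>g $ i\<bar>)"
  proof (rule sum_mono)
    fix i
    have *: "\<sigma> i * d $ i = \<sigma> i * x $ i - \<bar>g $ i\<bar>"
      by (auto simp: d_def \<sigma>_def sgn_if)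
    have "0 \<le> (\<sigma> i * x $ i - \<bar>g $ i\<bar>) * (h (\<sigma> i * x $ i) - h \<bar>g $ i\<bar>)"
      using h_mono[of "\<sigma> i * x $ i" "\<bar>g $ i\<bar>"] h_mono[of "\<bar>g $ i\<bar>" "\<sigma> i * x $ i"]
      by (cases "\<sigma> i * x $ i \<le> \<bar>g $ i\<bar>") (simp_all add: mult_nonpos_nonpos)
    then show "- (\<sigma> i * d $ i) * h (\<sigma> i * x $ i) \<le> - (\<sigma> i * d $ i) * h \<bar>g $ i\<bar>"
      unfolding * by (simp add: algebra_simps)
  qed
  \<comment> \<open>The constant part \<open>h m\<close> of the weights is paid for with
    \<open>\<rho>\<close>, the excess in \<open>[0, ln \<kappa>]\<close> with
    \<open>\<rho>m\<close>.\<close>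
  also have "\<dots> = - sgnd d * h m + (\<Sum>i\<in>supp g. - (\<sigma> i * d $ i) * (h \<bar>g $ i\<bar> - h m))"
    by (simp add: sum_negf sum_subtractf sum_distrib_right right_diff_distrib \<sigma>_def)
  also have "\<dots> \<le> (\<rho> * off d) * h m + neg d * ln \<kappa>"
  proof (rule add_mono)
    show "- sgnd d * h m \<le> (\<rho> * off d) * h m"
      using neg_sgnd_le[OF diff_in_ker] h_mono[of 0 m] min_abs_pos
      by (intro mult_right_mono) (auto simp: d_def)
    have "h \<bar>g $ i\<bar> - h m \<le> ln \<kappa>" if "i \<in> supp g" for i
    proof -
      have "h \<bar>g $ i\<bar> - h m \<le> h M - h m"
        using h_mono[OF abs_le_max_abs[OF that]] by simp
      also have "\<dots> \<le> ln \<kappa>"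
        unfolding kappa_def by (rule h_diff_le_ln[OF min_abs_pos min_abs_le_max_abs])
      finally show ?thesis .
    qed
    then show "(\<Sum>i\<in>supp g. - (\<sigma> i * d $ i) * (h \<bar>g $ i\<bar> - h m)) \<le> neg d * ln \<kappa>"
      unfolding \<sigma>_def using h_mono[OF min_abs_le] by (intro sum_weighted_le_neg) auto
  qed
  also have "\<dots> \<le> (\<rho> * off d) * ln (m / \<alpha> * (1 + \<alpha>\<^sup>2 / m\<^sup>2)) + (\<rho>m * off d) * ln \<kappa>"
  proof (intro add_mono mult_left_mono mult_right_mono)
    show "h m \<le> ln (m / \<alpha> * (1 + \<alpha>\<^sup>2 / m\<^sup>2))"
      using arsinh_le_ln[of "m / (2 * \<alpha>)"] min_abs_pos alpha_pos by (simp add: power_divide)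
    show "0 \<le> \<rho> * off d"
      using nsp_const_nonneg by (intro mult_nonneg_nonneg sum_nonneg) auto
    show "neg d \<le> \<rho>m * off d"
      using neg_le[OF diff_in_ker] by (simp add: d_def)
  qed (rule ln_kappa_nonneg)
  also have "\<dots> = off d * (\<rho> * ln (m / \<alpha> * (1 + \<alpha>\<^sup>2 / m\<^sup>2)) + \<rho>m * ln \<kappa>)"
    by (simp add: algebra_simps)
  finally show ?thesis
    by (simp only: d_def)
qed

lemma one_plus_ratio_pos: "0 < 1 + \<alpha>\<^sup>2 / m\<^sup>2"
  by (simp add: add_pos_nonneg)

lemma off_diff_le:
  "off (x - g) \<le> N * (\<alpha> powr (1 - \<rho>) * m powr \<rho> * \<kappa> powr \<rho>m * (1 + \<alpha>\<^sup>2 / m\<^sup>2) powr \<rho>)"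
proof (cases "off (x - g) = 0")
  case True
  then show ?thesis
    by simp
next
  case False
  let ?R = "\<rho> * ln (m / \<alpha> * (1 + \<alpha>\<^sup>2 / m\<^sup>2)) + \<rho>m * ln \<kappa>"
  have pos: "0 < off (x - g)"
    using False by (simp add: less_le sum_nonneg)
  \<comment> \<open>Jensen's inequality puts the mean \<open>off (x - g) / N\<close> inside a
    logarithm; cancelling the positive factor and exponentiating solves for it.\<close>
  have "off (x - g) * ln (off (x - g) / N / \<alpha>) \<le> (\<Sum>i\<in>- supp g. \<bar>x $ i\<bar> * h \<bar>x $ i\<bar>)"
    using pos alpha_pos unfolding off_diff by (intro sum_mult_arsinh_ge) auto
  also have "\<dots> \<le> off (x - g) * ?R"
    by (rule sum_abs_mult_h_le)
  finally have "ln (off (x - g) / N / \<alpha>) \<le> ?R"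
    using pos by simp
  then have "exp (ln (off (x - g) / N / \<alpha>)) \<le> exp ?R"
    by (simp only: exp_le_cancel_iff)
  then have "off (x - g) / N / \<alpha> \<le> exp ?R"
    using pos card_off_pos alpha_pos by (subst (asm) exp_ln) auto
  moreover have "exp ?R = (m / \<alpha> * (1 + \<alpha>\<^sup>2 / m\<^sup>2)) powr \<rho> * \<kappa> powr \<rho>m"
    using min_abs_pos alpha_pos one_plus_ratio_pos kappa_ge_1 by (simp add: exp_add powr_def)
  ultimately have "off (x - g)
      \<le> N * (\<alpha> * ((m / \<alpha> * (1 + \<alpha>\<^sup>2 / m\<^sup>2)) powr \<rho> * \<kappa> powr \<rho>m))"
    using card_off_pos alpha_pos by (simp add: field_simps)
  also have "\<alpha> * ((m / \<alpha> * (1 + \<alpha>\<^sup>2 / m\<^sup>2)) powr \<rho> * \<kappa> powr \<rho>m)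
      = \<alpha> powr (1 - \<rho>) * m powr \<rho> * \<kappa> powr \<rho>m * (1 + \<alpha>\<^sup>2 / m\<^sup>2) powr \<rho>"
    using min_abs_pos alpha_pos one_plus_ratio_pos
    by (simp add: powr_mult powr_divide powr_diff less_imp_le)
  finally show ?thesis .
qed

lemma upper_bound:
  "l1_norm (x - g) / \<alpha> powr (1 - \<rho>)
    \<le> N * (1 + \<rho>t) * m powr \<rho> * \<kappa> powr \<rho>m * (1 + \<alpha>\<^sup>2 / m\<^sup>2) powr \<rho>"
proof -
  have "l1_norm (x - g) \<le> (1 + \<rho>t) * off (x - g)"
    using on_le[OF diff_in_ker] unfolding l1_norm_split by (simp add: algebra_simps)
  also have "\<dots> \<le> (1 + \<rho>t)
      * (N * (\<alpha> powr (1 - \<rho>) * m powr \<rho> * \<kappa> powr \<rho>m * (1 + \<alpha>\<^sup>2 / m\<^sup>2) powr \<rho>))"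
    using off_diff_le nsp_const_nonneg nsp_const_le_tilde by (intro mult_left_mono) auto
  finally show ?thesis
    using alpha_pos by (simp add: field_simps)
qed

section \<open>Lower bound from all kernel vectors\<close>

text \<open>For each kernel vector, \<open>h M\<close> is split on the support into
  \<open>h (sgn (g $ i) * x $ i)\<close>, \<open>h M - h \<bar>g $ i\<bar>\<close> and the error
  controlled by \<open>E\<close>. Relative to \<open>off n\<close> these cost \<open>h b\<close>,
  \<open>\<rho>m * ln \<kappa>\<close> and \<open>\<rho>t * E\<close>; the supremum over
  \<open>n\<close> then produces \<open>\<rho>\<close>.\<close>

lemma h_off_ge:
  assumes E: "\<And>i. i \<in> supp g \<Longrightarrow> \<bar>h (sgn (g $ i) * x $ i) - h \<bar>g $ i\<bar>\<bar> \<le> E" "0 \<le> E"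
    and b: "\<And>i. i \<in> - supp g \<Longrightarrow> \<bar>x $ i\<bar> \<le> b"
  shows "\<rho> * h M \<le> h b + \<rho>m * ln \<kappa> + \<rho>t * E"
proof -
  have hM: "0 < h M"
    using max_abs_pos alpha_pos by simp
  have "\<rho> \<le> (h b + \<rho>m * ln \<kappa> + \<rho>t * E) / h M"
  proof (rule nsp_const_le)
    fix n assume n: "n \<in> matrix_ker A"
    define s where "s i = - (sgn (g $ i) * n $ i)" for i
    have 1: "(\<Sum>i\<in>supp g. s i * h (sgn (g $ i) * x $ i)) \<le> off n * h b"
    proof -
      have "(\<Sum>i\<in>supp g. s i * h (sgn (g $ i) * x $ i)) = (\<Sum>i\<in>- supp g. n $ i * h (x $ i))"
        unfolding s_def by (rule ker_balance[OF n, symmetric])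
      also have "\<dots> \<le> (\<Sum>i\<in>- supp g. \<bar>n $ i\<bar> * h b)"
      proof (rule sum_mono)
        fix i assume i: "i \<in> - supp g"
        have "n $ i * h (x $ i) \<le> \<bar>n $ i\<bar> * \<bar>h (x $ i)\<bar>"
          using abs_ge_self[of "n $ i * h (x $ i)"] by (simp add: abs_mult)
        also have "\<dots> \<le> \<bar>n $ i\<bar> * h b"
          unfolding h_abs using h_mono[OF b[OF i]] by (intro mult_left_mono) auto
        finally show "n $ i * h (x $ i) \<le> \<bar>n $ i\<bar> * h b" .
      qed
      finally show ?thesis
        by (simp add: sum_distrib_right)
    qed
    have "h M - h \<bar>g $ i\<bar> \<le> ln \<kappa>" if "i \<in> supp g" for i
    proof -
      have "h M - h \<bar>g $ i\<bar> \<le> h M - h m"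
        using h_mono[OF min_abs_le[OF that]] by simp
      also have "\<dots> \<le> ln \<kappa>"
        unfolding kappa_def by (rule h_diff_le_ln[OF min_abs_pos min_abs_le_max_abs])
      finally show ?thesis .
    qed
    then have "(\<Sum>i\<in>supp g. s i * (h M - h \<bar>g $ i\<bar>)) \<le> neg n * ln \<kappa>"
      unfolding s_def using h_mono[OF abs_le_max_abs] by (intro sum_weighted_le_neg) auto
    also have "\<dots> \<le> \<rho>m * off n * ln \<kappa>"
      by (rule mult_right_mono[OF neg_le[OF n] ln_kappa_nonneg])
    finally have 2: "(\<Sum>i\<in>supp g. s i * (h M - h \<bar>g $ i\<bar>)) \<le> \<rho>m * off n * ln \<kappa>" .
    have "(\<Sum>i\<in>supp g. s i * (h \<bar>g $ i\<bar> - h (sgn (g $ i) * x $ i))) \<le> (\<Sum>i\<in>supp g. \<bar>n $ i\<bar> * E)"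
    proof (rule sum_mono)
      fix i assume i: "i \<in> supp g"
      have "s i * (h \<bar>g $ i\<bar> - h (sgn (g $ i) * x $ i))
          \<le> \<bar>s i\<bar> * \<bar>h (sgn (g $ i) * x $ i) - h \<bar>g $ i\<bar>\<bar>"
        unfolding abs_mult[symmetric] by (smt (verit) minus_diff_eq mult_minus_right)
      also have "\<dots> \<le> \<bar>s i\<bar> * E"
        using E(1)[OF i] by (intro mult_left_mono) auto
      also have "\<bar>s i\<bar> = \<bar>n $ i\<bar>"
        using i by (simp add: s_def abs_mult supp_def)
      finally show "s i * (h \<bar>g $ i\<bar> - h (sgn (g $ i) * x $ i)) \<le> \<bar>n $ i\<bar> * E" .
    qed
    also have "\<dots> = on n * E"
      by (simp add: sum_distrib_right)
    also have "\<dots> \<le> \<rho>t * off n * E"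
      by (rule mult_right_mono[OF on_le[OF n] E(2)])
    finally have 3: "(\<Sum>i\<in>supp g. s i * (h \<bar>g $ i\<bar> - h (sgn (g $ i) * x $ i))) \<le> \<rho>t * off n * E" .
    have "- sgnd n * h M = (\<Sum>i\<in>supp g. s i * h (sgn (g $ i) * x $ i)
        + s i * (h M - h \<bar>g $ i\<bar>) + s i * (h \<bar>g $ i\<bar> - h (sgn (g $ i) * x $ i)))"
      unfolding sum_negf[symmetric] sum_distrib_right
      by (rule sum.cong) (simp_all add: s_def algebra_simps)
    also have "\<dots> \<le> off n * (h b + \<rho>m * ln \<kappa> + \<rho>t * E)"
      using 1 2 3 unfolding sum.distrib by (simp add: algebra_simps)
    finally show "- sgnd n \<le> (h b + \<rho>m * ln \<kappa> + \<rho>t * E) / h M * off n"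
      using hM by (simp add: pos_le_divide_eq mult.commute)
  qed
  then show ?thesis
    using hM by (simp only: pos_le_divide_eq)
qed

lemma lower_bound:
  assumes small: "\<rho>t = 0 \<or> \<alpha> / m \<le> (1 / (4 * \<rho>t * \<kappa> powr \<rho>m * N)) powr (1 / (1 - \<rho>))"
    and b: "\<And>i. i \<in> - supp g \<Longrightarrow> \<bar>x $ i\<bar> \<le> b" and b_nonneg: "0 \<le> b"
  shows "M powr \<rho> / \<kappa> powr \<rho>m
      * (1 - 8 * \<rho>t\<^sup>2 * N * \<kappa> powr \<rho>m * (\<alpha> / m) powr (1 - \<rho>)
           - \<kappa> powr (2 * \<rho>m - 2 * \<rho>) * (\<alpha> / m) powr (2 * \<rho>))
    \<le> b / \<alpha> powr (1 - \<rho>)"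
proof -
  define s where "s = \<alpha> / m"
  \<comment> \<open>Up to the factor \<open>(1 + s\<^sup>2) powr \<rho>\<close>, this is the bound
    on \<open>on (x - g)\<close> relative to \<open>m\<close>.\<close>
  define p where "p = \<rho>t * (N * (\<kappa> powr \<rho>m * s powr (1 - \<rho>)))"
  define Q where "Q = \<kappa> powr (2 * \<rho>m - 2 * \<rho>) * s powr (2 * \<rho>)"
  have P: "8 * \<rho>t\<^sup>2 * N * \<kappa> powr \<rho>m * (\<alpha> / m) powr (1 - \<rho>) = 8 * \<rho>t * p"
    by (simp add: p_def s_def power2_eq_square)
  have s: "0 < s"
    using alpha_pos min_abs_pos by (simp add: s_def)
  have \<rho>: "0 \<le> \<rho>" "\<rho> < 1" "\<rho> \<le> \<rho>t" "\<rho> \<le> \<rho>m"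
    using nsp_const_nonneg nsp_const_less_1 nsp_const_le_tilde nsp_const_le_minus by auto
  have N: "1 \<le> N"
    using card_off_pos by simp
  have \<kappa>: "1 \<le> \<kappa> powr \<rho>m"
    using kappa_ge_1 \<rho> by (intro ge_one_powr_ge_zero) auto
  have p_nonneg: "0 \<le> p"
    using \<rho> unfolding p_def by (intro mult_nonneg_nonneg) auto
  \<comment> \<open>In the nontrivial case \<open>Q < 1\<close>, which forces \<open>s < 1\<close> unless \<open>\<rho> = 0\<close>; only then is the
    factor \<open>(1 + s\<^sup>2) powr \<rho>\<close> of the upper bound under control.\<close>
  show ?thesis
  proof (cases "1 \<le> 8 * \<rho>t * p + Q")
    case True
    then have "M powr \<rho> / \<kappa> powr \<rho>m * (1 - 8 * \<rho>t * p - Q) \<le> 0"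
      by (intro mult_nonneg_nonpos) auto
    also have "0 \<le> b / \<alpha> powr (1 - \<rho>)"
      using b_nonneg by simp
    finally show ?thesis
      unfolding P by (simp only: Q_def s_def)
  next
    case False
    \<comment> \<open>This is the smallness assumption raised to the power
      \<open>1 - \<rho>\<close>.\<close>
    have p_le: "p \<le> 1 / 4"
    proof (cases "\<rho>t = 0")
      case True
      then show ?thesis by (simp add: p_def)
    next
      case rt: False
      define c where "c = 4 * \<rho>t * \<kappa> powr \<rho>m * N"
      have c: "0 < c"
        unfolding c_def using rt \<rho> \<kappa> N by (intro mult_pos_pos) linarith+
      have "s powr (1 - \<rho>) \<le> ((1 / c) powr (1 / (1 - \<rho>))) powr (1 - \<rho>)"
        using small rt s \<rho> by (intro powr_mono2) (auto simp: s_def c_def)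
      also have "\<dots> = 1 / c"
        using \<rho> c by (simp add: powr_powr)
      finally have "c * s powr (1 - \<rho>) \<le> 1"
        using c by (simp add: field_simps)
      then show ?thesis
        by (simp add: p_def c_def algebra_simps)
    qed
    have K: "(1 + s\<^sup>2) powr \<rho> \<le> 5 / 4"
    proof (cases "\<rho> = 0")
      case True
      then show ?thesis
        by simp
    next
      case rho: False
      have "1 * s powr (2 * \<rho>) \<le> Q"
        unfolding Q_def using kappa_ge_1 \<rho> by (intro mult_right_mono ge_one_powr_ge_zero) auto
      moreover have "0 \<le> 8 * \<rho>t * p"
        using \<rho> p_nonneg by simp
      ultimately have "s powr (2 * \<rho>) < 1"
        using False by linarith
      then have "s < 1"
        using rho \<rho> ge_one_powr_ge_zero[of s "2 * \<rho>"] by linarith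
      moreover have "\<rho> * s powr (1 - \<rho>) \<le> 1 / 4"
      proof -
        have "\<rho> * s powr (1 - \<rho>) \<le> \<rho>t * (1 * (1 * s powr (1 - \<rho>)))"
          using \<rho> by (simp add: mult_right_mono)
        also have "\<dots> \<le> p"
          unfolding p_def using \<rho> N \<kappa> by (intro mult_left_mono mult_mono) auto
        finally show ?thesis
          using p_le by linarith
      qed
      ultimately show ?thesis
        using s \<rho> by (intro powr_one_plus_sq_le) auto
    qed
    have on: "on (x - g) \<le> 5 / 4 * p * m"
    proof -
      have "on (x - g) \<le> \<rho>t * off (x - g)"
        by (rule on_le[OF diff_in_ker])
      also have "\<dots> \<le> \<rho>t
          * (N * (\<alpha> powr (1 - \<rho>) * m powr \<rho> * \<kappa> powr \<rho>m * (1 + \<alpha>\<^sup>2 / m\<^sup>2) powr \<rho>))"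
        using off_diff_le \<rho> by (intro mult_left_mono) auto
      also have "\<alpha> powr (1 - \<rho>) * m powr \<rho> = m * s powr (1 - \<rho>)"
        using alpha_pos min_abs_pos by (simp add: s_def powr_divide powr_diff)
      also have "(1 + \<alpha>\<^sup>2 / m\<^sup>2) powr \<rho> = (1 + s\<^sup>2) powr \<rho>"
        by (simp add: s_def power_divide)
      also have "\<rho>t * (N * (m * s powr (1 - \<rho>) * \<kappa> powr \<rho>m * (1 + s\<^sup>2) powr \<rho>))
          = (1 + s\<^sup>2) powr \<rho> * (p * m)"
        by (simp add: p_def)
      also have "\<dots> \<le> 5 / 4 * (p * m)"
        using K p_nonneg min_abs_pos by (intro mult_right_mono) auto
      finally show ?thesis by simp
    qed
    \<comment> \<open>Entries on the support move by at most
      \<open>5 / 4 * p * m \<le> 5 / 16 * m\<close>, hence stay above \<open>11 / 16 * m\<close>;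
      the Lipschitz bound gives \<open>(5 / 4) / (11 / 16) = 20 / 11\<close>.\<close>
    define E where "E = 20 / 11 * p"
    have E: "\<bar>h (sgn (g $ i) * x $ i) - h \<bar>g $ i\<bar>\<bar> \<le> E" if i: "i \<in> supp g" for i
    proof -
      have eq: "\<bar>sgn (g $ i) * x $ i - \<bar>g $ i\<bar>\<bar> = \<bar>(x - g) $ i\<bar>"
        using i by (auto simp: supp_def sgn_if)
      have d: "\<bar>(x - g) $ i\<bar> \<le> 5 / 4 * p * m"
        using member_le_sum[OF i, of "\<lambda>i. \<bar>(x - g) $ i\<bar>"] on by simp
      also have "\<dots> \<le> 5 / 16 * m"
        using p_le min_abs_pos by simp
      finally have "11 / 16 * m \<le> sgn (g $ i) * x $ i" "11 / 16 * m \<le> \<bar>g $ i\<bar>"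
        using min_abs_le[OF i] min_abs_pos unfolding eq[symmetric] by linarith+
      then have "\<bar>h (sgn (g $ i) * x $ i) - h \<bar>g $ i\<bar>\<bar> \<le> \<bar>(x - g) $ i\<bar> / (11 / 16 * m)"
        unfolding eq[symmetric] using min_abs_pos by (intro h_lipschitz) auto
      also have "\<dots> \<le> 5 / 4 * p * m / (11 / 16 * m)"
        using d min_abs_pos by (intro divide_right_mono) auto
      also have "\<dots> = E"
        using min_abs_pos by (simp add: E_def)
      finally show ?thesis .
    qed
    define t where "t = \<rho>t * E"
    have t: "0 \<le> t" "3 * t \<le> 8 * \<rho>t * p" "t \<le> 1"
    proof -
      show "0 \<le> t" "3 * t \<le> 8 * \<rho>t * p"
        using \<rho> p_nonneg mult_nonneg_nonneg[of \<rho>t p] by (simp_all add: t_def E_def)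
      moreover have "0 \<le> Q"
        by (simp add: Q_def)
      ultimately show "t \<le> 1"
        using False by linarith
    qed
    \<comment> \<open>\<open>R\<close> is a lower bound for \<open>h b\<close>; applying
      \<open>sinh\<close> gives \<open>2 * \<alpha> * sinh R \<le> b\<close>.\<close>
    define R where "R = \<rho> * ln (M / \<alpha>) - \<rho>m * ln \<kappa> - t"
    have "\<rho> * ln (M / \<alpha>) \<le> \<rho> * h M"
      using ln_double_le_arsinh[of "M / (2 * \<alpha>)"] max_abs_pos alpha_pos \<rho>
      by (intro mult_left_mono) auto
    then have "R \<le> h b"
      using h_off_ge[OF E _ b] p_nonneg by (simp add: R_def t_def E_def)
    then have "sinh R \<le> b / (2 * \<alpha>)"
      using sinh_real_le_iff[of R "h b"] by simp
    then have sinh: "\<alpha> * (exp R - exp (- R)) \<le> b"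
      using alpha_pos by (simp add: sinh_def field_simps)
    define Z where "Z = (M / \<alpha>) powr \<rho> / \<kappa> powr \<rho>m"
    have Z: "0 < Z"
      using max_abs_pos alpha_pos kappa_ge_1 by (simp add: Z_def)
    have expZ: "exp (\<rho> * ln (M / \<alpha>) - \<rho>m * ln \<kappa>) = Z"
      using max_abs_pos alpha_pos kappa_ge_1 by (simp add: Z_def exp_diff powr_def)
    have expR: "exp R = Z * exp (- t)" "exp (- R) = exp t / Z"
      unfolding expZ[symmetric] R_def by (simp_all flip: exp_add exp_diff)
    \<comment> \<open>Because \<open>s = \<kappa> * \<alpha> / M\<close>, \<open>Q\<close> equals
      \<open>1 / Z\<^sup>2\<close>; thus \<open>exp (- R)\<close> yields the last error term of the
      bound.\<close>
    have Q: "1 / Z = Z * Q"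
    proof -
      define w where "w = \<rho> * ln (M / \<alpha>) - \<rho>m * ln \<kappa>"
      have "ln s + ln (M / \<alpha>) = ln \<kappa>"
        using alpha_pos max_abs_pos min_abs_pos by (simp add: s_def kappa_def ln_div)
      then have ln_s: "ln s = ln \<kappa> - ln (M / \<alpha>)"
        by linarith
      have "(2 * \<rho>m - 2 * \<rho>) * ln \<kappa> + 2 * \<rho> * ln s = - w - w"
        unfolding ln_s w_def by (simp add: algebra_simps)
      moreover have "Q = exp ((2 * \<rho>m - 2 * \<rho>) * ln \<kappa> + 2 * \<rho> * ln s)"
        using kappa_ge_1 s by (simp add: Q_def powr_def exp_add)
      ultimately have Q_eq: "Q = exp (- w - w)"
        by (simp only:)
      show ?thesis
        unfolding expZ[symmetric] w_def[symmetric] Q_eq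
        by (simp only: mult_exp_exp exp_minus[symmetric] inverse_eq_divide[symmetric]) simp
    qed
    \<comment> \<open>The loss is at most \<open>3 * t\<close>: one \<open>t\<close> from
      \<open>exp (- t)\<close>, two from \<open>exp t \<le> 1 + 2 * t\<close> together with
      \<open>Q \<le> 1\<close>.\<close>
    have "1 - 8 * \<rho>t * p - Q \<le> exp (- t) - exp t * Q"
    proof -
      have "exp t \<le> 1 + 2 * t"
        using exp_bound[of t] t mult_left_le[of t t] by (simp add: power2_eq_square)
      then have "exp t * Q \<le> (1 + 2 * t) * Q"
        by (intro mult_right_mono) (simp_all add: Q_def)
      moreover have "2 * t * Q \<le> 2 * t * 1"
        using False t by (intro mult_left_mono) auto
      ultimately have "exp t * Q \<le> Q + 2 * t"
        by (simp add: algebra_simps)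
      moreover have "1 - t \<le> exp (- t)"
        using exp_ge_add_one_self[of "- t"] by simp
      ultimately show ?thesis
        using t by linarith
    qed
    then have "\<alpha> * Z * (1 - 8 * \<rho>t * p - Q) \<le> \<alpha> * Z * (exp (- t) - exp t * Q)"
      using alpha_pos Z by (intro mult_left_mono) auto
    also have "\<dots> = \<alpha> * (exp R - exp (- R))"
    proof -
      have "exp (- R) = Z * (exp t * Q)"
        using arg_cong[OF Q, of "\<lambda>u. exp t * u"] unfolding expR(2) by (simp add: mult.left_commute)
      then show ?thesis
        unfolding expR(1) by (simp only: right_diff_distrib mult.assoc)
    qed
    also have "\<dots> \<le> b"
      by (rule sinh)
    finally have "\<alpha> * Z * (1 - 8 * \<rho>t * p - Q) / \<alpha> powr (1 - \<rho>) \<le> b / \<alpha> powr (1 - \<rho>)"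
      by (rule divide_right_mono) simp
    moreover have "\<alpha> * Z / \<alpha> powr (1 - \<rho>) = M powr \<rho> / \<kappa> powr \<rho>m"
      using alpha_pos max_abs_pos by (simp add: Z_def powr_divide powr_diff)
    ultimately show ?thesis
      unfolding P by (simp add: Q_def s_def flip: times_divide_eq_left)
  qed
qed

end

section \<open>Transfer to the two minimization problems\<close>

theorem theorem2p6:
  fixes A :: "real ^ 'd ^ 'n" and y :: "real ^ 'n" and g xinf :: "real ^ 'd" and \<alpha> :: real
  assumes feasible: "\<exists>x. A *v x = y"
    and y_nonzero: "y \<noteq> 0"
    and ker_nontrivial: "matrix_ker A \<noteq> {0}"
    and unique_min: "{x. is_arg_min l1_norm (\<lambda>x. A *v x = y) x} = {g}"
    and alpha_pos: "\<alpha> > 0"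
    and xinf_min: "is_arg_min (\<lambda>x. bregman_div (hyp_entropy \<alpha>) x 0) (\<lambda>x. A *v x = y) xinf"
  defines "\<rho> \<equiv> nsp_const A g"
    and "\<rho>m \<equiv> nsp_const_minus A g"
    and "\<rho>t \<equiv> nsp_const_tilde A g"
    and "\<kappa> \<equiv> kappa g"
    and "m \<equiv> min_abs g"
    and "Sc \<equiv> - supp g"
  shows "l1_norm (xinf - g) / \<alpha> powr (1 - \<rho>)
           \<le> real (card Sc) * (1 + \<rho>t) * m powr \<rho> * \<kappa> powr \<rho>m * (1 + \<alpha>\<^sup>2 / m\<^sup>2) powr \<rho>
         \<and>
         ((\<rho>t = 0 \<or> \<alpha> / m \<le> (1 / (4 * \<rho>t * \<kappa> powr \<rho>m * real (card Sc))) powr (1 / (1 - \<rho>)))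
          \<longrightarrow>
          infnorm (restrict_vec xinf Sc - restrict_vec g Sc) / \<alpha> powr (1 - \<rho>)
            \<ge> infnorm g powr \<rho> / \<kappa> powr \<rho>m
                * (1 - 8 * \<rho>t\<^sup>2 * real (card Sc) * \<kappa> powr \<rho>m * (\<alpha> / m) powr (1 - \<rho>)
                     - \<kappa> powr (2 * \<rho>m - 2 * \<rho>) * (\<alpha> / m) powr (2 * \<rho>)))"
proof -
  have g: "is_arg_min l1_norm (\<lambda>x. A *v x = y) g"
    and g_unique: "\<And>x. is_arg_min l1_norm (\<lambda>x. A *v x = y) x \<Longrightarrow> x = g"
    using unique_min by auto
  have Ag: "A *v g = y"
    using g by (simp add: is_arg_min_def)
  \<comment> \<open>A feasible competitor of no larger norm would be a second minimizer.\<close>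
  have "l1_norm g < l1_norm x" if "A *v x = y" "x \<noteq> g" for x
  proof (rule ccontr)
    assume "\<not> l1_norm g < l1_norm x"
    then have "is_arg_min l1_norm (\<lambda>x. A *v x = y) x"
      using g that(1) unfolding is_arg_min_def by (meson le_less_trans not_less)
    then show False
      using g_unique that(2) by blast
  qed
  moreover have "g \<noteq> 0"
    using Ag y_nonzero by auto
  moreover have "A *v xinf = y"
    using xinf_min by (simp add: is_arg_min_def)
  ultimately interpret entropic_minimizer A g \<alpha> xinf
    using ker_nontrivial alpha_pos Ag bregman_minimizer_stationary[OF alpha_pos xinf_min]
    by unfold_locales auto
  \<comment> \<open>As \<open>g\<close> vanishes off its support, the maximum norm of the restricted
    difference can serve as \<open>b\<close>.\<close>
  have off: "\<bar>xinf $ i\<bar> \<le> infnorm (restrict_vec xinf (- supp g) - restrict_vec g (- supp g))"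
    if "i \<in> - supp g" for i
    using component_le_infnorm_cart[of "restrict_vec xinf (- supp g) - restrict_vec g (- supp g)" i] that
    by (simp add: restrict_vec_def supp_def)
  show ?thesis
    unfolding assms(7-12) infnorm_eq_max_abs
    using upper_bound lower_bound[OF _ off infnorm_pos_le] by blast
qed

end
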